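(* Let $r\ge 2$, let $\alpha_1,\dots,\alpha_r,\beta_1,\dots,\beta_r,\gamma>-1$ be real numbers with $(\alpha_i,\beta_i)\neq(\alpha_j,\beta_j)$ for $i\ne j$, and let $0\le k_j\le n_j$ ($j=1,\dots,r$) be integers, with $|\vec n|=n_1+\cdots+n_r$. Let $\pi$ be any permutation of $\{1,\dots,r\}$. Then $$U^{(\vec\alpha,\vec\beta,\gamma)}_{\vec n,\vec k}(x,y)=D_r\circ\cdots\circ D_1\big[(1-x-y)^{|\vec n|}\big]=D_{\pi(1)}\circ\cdots\circ D_{\pi(r)}\big[(1-x-y)^{|\vec n|}\big].$$
   Context: Let $T=\{(x,y)\in\mathbb R^2: x\ge 0,\ y\ge 0,\ x+y\le 1\}$ and $W_j(x,y)=x^{\alpha_j}y^{\beta_j}(1-x-y)^{\gamma}$ for $j=1,\dots,r$. For integers $0\le k_j\le n_j$ and a smooth function $f$, the operator $D_j$ is $$D_j[f(x,y)]=\frac{1}{W_j(x,y)}\,\frac{\partial^{n_j}}{\partial x^{n_j-k_j}\,\partial y^{k_j}}\Big(W_j(x,y)\,x^{n_j-k_j}y^{k_j}f(x,y)\Big).$$ All these expressions are taken on the interior of $T$ (where $W_j$ is smooth and positive). The function $U^{(\vec\alpha,\vec\beta,\gamma)}_{\vec n,\vec k}$, with $\vec n=(n_1,\dots,n_r)$, $\vec k=(k_1,\dots,k_r)$, $\vec\alpha=(\alpha_1,\dots,\alpha_r)$, $\vec\beta=(\beta_1,\dots,\beta_r)$, is by definition $D_r\circ\cdots\circ D_1[(1-x-y)^{|\vec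 n|}]$. *)

theory Defs
  imports "HOL-Analysis.Analysis" "HOL-Combinatorics.Permutations"
begin

definition std_triangle :: "(real \<times> real) set" where
  "std_triangle = {(x, y). x \<ge> 0 \<and> y \<ge> 0 \<and> x + y \<le> 1}"

text \<open>
  Functions on the interior of the triangle are represented by total functions on the plane.
  Partial derivatives at a point depend only on the values in a neighbourhood of that point, so
  at interior points of the triangle all operators below depend only on the values of
  their argument on the (open) interior; values elsewhere are irrelevant.
\<close>

definition partial_x :: "(real \<times> real \<Rightarrow> real) \<Rightarrow> real \<times> real \<Rightarrow> real" where
  "partial_x f = (\<lambda>(x, y). deriv (\<lambda>s. f (s, y)) x)"

definition partial_y :: "(real \<times> real \<Rightarrow> real) \<Rightarrow> real \<times> real \<Rightarrow> real" where
  "partial_y f = (\<lambda>(x, y). deriv (\<lambda>t. f (x, t)) y)"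

definition weight :: "real \<Rightarrow> real \<Rightarrow> real \<Rightarrow> real \<times> real \<Rightarrow> real" where
  "weight a b g = (\<lambda>(x, y). x powr a * y powr b * (1 - x - y) powr g)"

text \<open>The subtraction \<open>n - k\<close> is on natural numbers; the operator is meant for \<open>k \<le> n\<close>.\<close>

definition rodrigues_op ::
  "real \<Rightarrow> real \<Rightarrow> real \<Rightarrow> nat \<Rightarrow> nat \<Rightarrow> (real \<times> real \<Rightarrow> real) \<Rightarrow> real \<times> real \<Rightarrow> real" where
  "rodrigues_op a b g n k f = (\<lambda>p.
     1 / weight a b g p *
     (partial_x ^^ (n - k)) ((partial_y ^^ k)
       (\<lambda>(x, y). weight a b g (x, y) * x ^ (n - k) * y ^ k * f (x, y))) p)"

text \<open>\<open>compose_list [F\<^sub>1, \<dots>, F\<^sub>m] = F\<^sub>1 \<circ> \<dots> \<circ> F\<^sub>m\<close>; the last operator is applied first.\<close>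

definition compose_list :: "('a \<Rightarrow> 'a) list \<Rightarrow> 'a \<Rightarrow> 'a" where
  "compose_list Fs = foldr (\<circ>) Fs id"

text \<open>Vectors of length \<open>r\<close> are functions on the natural numbers, read at the indices \<open>1, \<dots>, r\<close>.\<close>

definition U_fun ::
  "nat \<Rightarrow> (nat \<Rightarrow> real) \<Rightarrow> (nat \<Rightarrow> real) \<Rightarrow> real \<Rightarrow> (nat \<Rightarrow> nat) \<Rightarrow> (nat \<Rightarrow> nat) \<Rightarrow>
   real \<times> real \<Rightarrow> real" where
  "U_fun r \<alpha> \<beta> \<gamma> n k =
     compose_list (map (\<lambda>j. rodrigues_op (\<alpha> j) (\<beta> j) \<gamma> (n j) (k j)) (rev [1..<Suc r]))
       (\<lambda>(x, y). (1 - x - y) ^ (\<Sum>j=1..r. n j))"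

end

theory Submission imports Defs begin

text \<open>
  Conjugating by \<open>(1 - x - y) powr \<gamma>\<close> turns \<open>D\<^sub>j\<close> into a product of factors
  \<open>x \<partial>\<^sub>x + c\<close> and \<open>y \<partial>\<^sub>y + c\<close>, because \<open>x\<^sup>-\<^sup>a \<partial>\<^sub>x\<^sup>m x\<^sup>a\<^sup>+\<^sup>m\<close> is the product of
  the Euler operators \<open>x \<partial>\<^sub>x + a + i\<close> for \<open>1 \<le> i \<le> m\<close>. All these factors commute with each other, so
  the order of the \<open>D\<^sub>j\<close> does not matter. The argument takes place in the linear span of the
  functions \<open>weight a b c\<close> with arbitrary real exponents, which is closed under multiplication and
  partial derivatives.
\<close>

section \<open>Functions on the open triangle: locality of derivatives and symmetry in the
  coordinates\<close>

text \<open>Outside the open triangle \<open>powr\<close> at nonpositive bases and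
  \<open>deriv\<close> at points without a derivative yield values of no interest. All operators
  below respect this relation, so it replaces equality in the calculations.\<close>

definition agree :: "(real \<times> real \<Rightarrow> real) \<Rightarrow> (real \<times> real \<Rightarrow> real) \<Rightarrow> bool" (infix "\<doteq>" 50) where
  "f \<doteq> g \<longleftrightarrow> (\<forall>p \<in> interior std_triangle. f p = g p)"

lemma agree_refl [simp]: "f \<doteq> f"
  by (simp add: agree_def)

lemma agree_sym: "f \<doteq> g \<Longrightarrow> g \<doteq> f"
  by (simp add: agree_def)

lemma agree_trans [trans]: "f \<doteq> g \<Longrightarrow> g \<doteq> h \<Longrightarrow> f \<doteq> h"
  by (simp add: agree_def)

lemma agree_add: "f \<doteq> f' \<Longrightarrow> g \<doteq> g' \<Longrightarrow> (\<lambda>p. f p + g p) \<doteq> (\<lambda>p. f' p + g' p)"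
  by (simp add: agree_def)

lemma interior_std_triangleD:
  assumes "(x, y) \<in> interior std_triangle"
  shows "x > 0" "y > 0" "x + y < 1"
proof -
  obtain e where e: "e > 0" "cball (x, y) e \<subseteq> std_triangle"
    using assms mem_interior_cball by blast
  \<comment> \<open>The closed ball contains points at distance exactly \<open>e\<close>. Shifting
    by \<open>e\<close> turns the weak inequalities of the triangle into strict ones at the
    centre.\<close>
  have "(x - e, y) \<in> cball (x, y) e" "(x, y - e) \<in> cball (x, y) e" "(x + e, y) \<in> cball (x, y) e"
    using e(1) by (simp_all add: dist_Pair_Pair dist_real_def)
  then have "(x - e, y) \<in> std_triangle" "(x, y - e) \<in> std_triangle" "(x + e, y) \<in> std_triangle"
    using e(2) by blast+
  then show "x > 0" "y > 0" "x + y < 1"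
    using e(1) by (simp_all add: std_triangle_def)
qed

lemma interior_std_triangle_commute:
  assumes "(x, y) \<in> interior std_triangle"
  shows "(y, x) \<in> interior std_triangle"
proof -
  obtain e where e: "e > 0" "ball (x, y) e \<subseteq> std_triangle"
    using assms mem_interior by blast
  have "ball (y, x) e \<subseteq> std_triangle"
  proof
    fix q assume q: "q \<in> ball (y, x) e"
    obtain u v where uv: "q = (u, v)" by (cases q)
    have "dist (x, y) (v, u) = dist (y, x) (u, v)"
      unfolding dist_Pair_Pair by (subst add.commute) (rule refl)
    then have "(v, u) \<in> std_triangle" using e(2) q uv by auto
    then show "q \<in> std_triangle" unfolding uv std_triangle_def by simp
  qed
  then show ?thesis using e(1) mem_interior by blast
qed

lemma interior_std_triangle_swap:
  "prod.swap p \<in> interior std_triangle \<longleftrightarrow> p \<in> interior std_triangle"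
  by (cases p) (metis interior_std_triangle_commute swap_simp)

lemma eventually_interior_x:
  assumes "(x, y) \<in> interior std_triangle"
  shows "eventually (\<lambda>s. (s, y) \<in> interior std_triangle) (nhds x)"
proof -
  have "open ((\<lambda>s. (s, y)) -` interior std_triangle)"
    by (intro open_vimage continuous_intros open_interior)
  from eventually_nhds_in_open[OF this, of x] show ?thesis
    using assms by simp
qed

text \<open>The triangle is symmetric under exchange of the coordinates, and
  \<open>partial_y\<close> is \<open>partial_x\<close> conjugated by this exchange. Most facts about
  y are derived from those about x in this way.\<close>

lemma partial_y_swap: "partial_y f = partial_x (f \<circ> prod.swap) \<circ> prod.swap"
  by (simp add: partial_x_def partial_y_def fun_eq_iff)

lemma comp_swap_swap: "f \<circ> prod.swap \<circ> prod.swap = f"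
  by (rule ext) simp

lemma agree_swap: "f \<circ> prod.swap \<doteq> g \<circ> prod.swap \<longleftrightarrow> f \<doteq> g"
proof -
  have "f \<circ> prod.swap \<doteq> g \<circ> prod.swap" if "f \<doteq> g" for f g
    using that by (simp add: agree_def interior_std_triangle_swap)
  from this[of f g] this[of "f \<circ> prod.swap" "g \<circ> prod.swap"] show ?thesis
    by (auto simp only: comp_swap_swap)
qed

text \<open>The interior is open, so it contains a small horizontal segment around each of its
  points, and the derivative sees only values on that segment.\<close>

lemma partial_x_cong:
  assumes "f \<doteq> g"
  shows "partial_x f \<doteq> partial_x g"
  unfolding agree_def
proof clarify
  fix x y :: real assume "(x, y) \<in> interior std_triangle"
  from eventually_interior_x[OF this] have "eventually (\<lambda>s. f (s, y) = g (s, y)) (nhds x)"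
    by (rule eventually_mono) (use assms in \<open>simp add: agree_def\<close>)
  then show "partial_x f (x, y) = partial_x g (x, y)"
    by (simp add: partial_x_def deriv_cong_ev)
qed

lemma partial_y_cong: "f \<doteq> g \<Longrightarrow> partial_y f \<doteq> partial_y g"
  using partial_x_cong[of "f \<circ> prod.swap" "g \<circ> prod.swap"]
  by (simp add: partial_y_swap agree_swap)

lemma partial_x_eqI:
  "((\<lambda>s. f (s, y)) has_real_derivative D) (at x) \<Longrightarrow> partial_x f (x, y) = D"
  by (simp add: partial_x_def DERIV_imp_deriv)

lemma partial_y_eqI:
  "((\<lambda>t. f (x, t)) has_real_derivative D) (at y) \<Longrightarrow> partial_y f (x, y) = D"
  by (simp add: partial_y_def DERIV_imp_deriv)

section \<open>The linear span of the weights and its partial derivatives\<close>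

text \<open>The clause \<open>cong\<close> makes membership depend on the values in the open
  triangle alone, since the derivative of a weight is computed as a combination of weights only
  there. Induction reduces linear claims to a single scaled weight.\<close>

inductive_set weight_span :: "(real \<times> real \<Rightarrow> real) set" where
  scaled_weight: "(\<lambda>p. r * weight a b c p) \<in> weight_span"
| add: "f \<in> weight_span \<Longrightarrow> g \<in> weight_span \<Longrightarrow> (\<lambda>p. f p + g p) \<in> weight_span"
| cong: "f \<in> weight_span \<Longrightarrow> f \<doteq> g \<Longrightarrow> g \<in> weight_span"

lemma weight_swap: "weight a b c (y, x) = weight b a c (x, y)"
  by (simp add: weight_def algebra_simps)

lemma weight_mult:
  "weight a b c p * weight a' b' c' p = weight (a + a') (b + b') (c + c') p"
  by (cases p) (simp add: weight_def powr_add)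

lemma weight_span_swap: "f \<in> weight_span \<Longrightarrow> f \<circ> prod.swap \<in> weight_span"
proof (induction rule: weight_span.induct)
  case (scaled_weight r a b c)
  have "(\<lambda>p. r * weight a b c p) \<circ> prod.swap = (\<lambda>p. r * weight b a c p)"
    by (auto simp: weight_swap)
  then show ?case by (simp add: weight_span.scaled_weight)
next
  case (add f g)
  then show ?case using weight_span.add[of "f \<circ> prod.swap" "g \<circ> prod.swap"] by (simp add: o_def)
next
  case (cong f g)
  then show ?case using weight_span.cong agree_swap by blast
qed

text \<open>Weights multiply by adding exponents (\<open>weight_mult\<close>); one induction for
  each factor extends this bilinearly.\<close>

lemma weight_span_mult:
  assumes "f \<in> weight_span" "g \<in> weight_span"
  shows "(\<lambda>p. f p * g p) \<in> weight_span"
  using assms(1)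
proof (induction rule: weight_span.induct)
  case (scaled_weight r a b c)
  show ?case using assms(2)
  proof (induction rule: weight_span.induct)
    case (scaled_weight r' a' b' c')
    have "(\<lambda>p. r * weight a b c p * (r' * weight a' b' c' p))
        = (\<lambda>p. (r * r') * weight (a + a') (b + b') (c + c') p)"
      by (simp add: weight_mult[symmetric] algebra_simps)
    then show ?case by (simp add: weight_span.scaled_weight)
  next
    case (add f g)
    then show ?case using weight_span.add by (simp add: distrib_left)
  next
    case (cong f g)
    then show ?case by (auto simp: agree_def intro: weight_span.cong)
  qed
next
  case (add f g)
  then show ?case using weight_span.add by (simp add: distrib_right)
next
  case (cong f g)
  then show ?case by (auto simp: agree_def intro: weight_span.cong)
qed

lemma DERIV_weight_x:
  assumes "(x, y) \<in> interior std_triangle"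
  shows "((\<lambda>s. weight a b c (s, y)) has_real_derivative
    a * weight (a - 1) b c (x, y) - c * weight a b (c - 1) (x, y)) (at x)"
  using interior_std_triangleD[OF assms] unfolding weight_def
  by (auto intro!: derivative_eq_intros simp: algebra_simps powr_diff)

text \<open>The right side is kept literally a sum of two scaled weights, with the sign inside the
  coefficient, so that the rules \<open>add\<close> and \<open>scaled_weight\<close> apply to it
  directly.\<close>

lemma partial_x_weight:
  "partial_x (\<lambda>p. r * weight a b c p)
    \<doteq> (\<lambda>p. r * a * weight (a - 1) b c p + - r * c * weight a b (c - 1) p)"
  unfolding agree_def
proof clarify
  fix x y :: real assume "(x, y) \<in> interior std_triangle"
  from DERIV_cmult[OF DERIV_weight_x[OF this], of r a b c]
  show "partial_x (\<lambda>p. r * weight a b c p) (x, y)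
      = r * a * weight (a - 1) b c (x, y) + - r * c * weight a b (c - 1) (x, y)"
    by (intro partial_x_eqI) (simp add: algebra_simps)
qed

lemma partial_y_weight:
  "partial_y (\<lambda>p. r * weight a b c p)
    \<doteq> (\<lambda>p. r * b * weight a (b - 1) c p + - r * c * weight a b (c - 1) p)"
  unfolding agree_def
proof clarify
  fix x y :: real assume "(x, y) \<in> interior std_triangle"
  then have "(y, x) \<in> interior std_triangle"
    by (rule interior_std_triangle_commute)
  moreover have "(\<lambda>p. r * weight a b c p) \<circ> prod.swap = (\<lambda>p. r * weight b a c p)"
    by (auto simp: weight_swap)
  ultimately have "partial_y (\<lambda>p. r * weight a b c p) (x, y)
      = r * b * weight (b - 1) a c (y, x) + - r * c * weight b a (c - 1) (y, x)"
    using partial_x_weight[of r b a c] by (simp add: partial_y_swap agree_def)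
  then show "partial_y (\<lambda>p. r * weight a b c p) (x, y)
      = r * b * weight a (b - 1) c (x, y) + - r * c * weight a b (c - 1) (x, y)"
    by (simp only: weight_swap[of _ _ _ y x])
qed

text \<open>\<open>deriv\<close> is a mere choice where no derivative exists, so the sum and product
  rules for \<open>partial_x\<close> require genuine differentiability. Weights have it because all
  their bases are positive in the interior, and it passes to sums and to functions that agree
  nearby.\<close>

lemma weight_span_DERIV_x:
  assumes "f \<in> weight_span" "(x, y) \<in> interior std_triangle"
  shows "((\<lambda>s. f (s, y)) has_real_derivative partial_x f (x, y)) (at x)"
proof -
  have "(\<lambda>s. f (s, y)) field_differentiable (at x)"
    using assms(1)
  proof (induction rule: weight_span.induct)
    case (scaled_weight r a b c)
    show ?case
      unfolding field_differentiable_def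
      by (rule exI, rule DERIV_cmult[OF DERIV_weight_x[OF assms(2)]])
  next
    case (add f g)
    then show ?case by (simp add: field_differentiable_add)
  next
    case (cong f g)
    then obtain D where "((\<lambda>s. f (s, y)) has_real_derivative D) (at x)"
      using field_differentiable_def by blast
    moreover have "eventually (\<lambda>s. f (s, y) = g (s, y)) (nhds x)"
      using eventually_interior_x[OF assms(2)] cong(2)
      by (auto elim!: eventually_mono simp: agree_def)
    ultimately have "((\<lambda>s. g (s, y)) has_real_derivative D) (at x)"
      using DERIV_cong_ev[OF refl _ refl, of "\<lambda>s. f (s, y)" "\<lambda>s. g (s, y)" x D] by simp
    then show ?case
      unfolding field_differentiable_def by (rule exI)
  qed
  then show ?thesis
    by (simp add: partial_x_def field_differentiable_derivI)
qed

lemma weight_span_DERIV_y: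
  assumes "f \<in> weight_span" "(x, y) \<in> interior std_triangle"
  shows "((\<lambda>t. f (x, t)) has_real_derivative partial_y f (x, y)) (at y)"
  using weight_span_DERIV_x[OF weight_span_swap[OF assms(1)]
      interior_std_triangle_commute[OF assms(2)]]
  by (simp add: partial_y_swap)

lemma partial_x_add:
  "f \<in> weight_span \<Longrightarrow> g \<in> weight_span \<Longrightarrow>
    partial_x (\<lambda>p. f p + g p) \<doteq> (\<lambda>p. partial_x f p + partial_x g p)"
  unfolding agree_def
  by (clarify, rule partial_x_eqI, rule DERIV_add) (rule weight_span_DERIV_x; assumption)+

lemma partial_y_add:
  "f \<in> weight_span \<Longrightarrow> g \<in> weight_span \<Longrightarrow>
    partial_y (\<lambda>p. f p + g p) \<doteq> (\<lambda>p. partial_y f p + partial_y g p)"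
  unfolding agree_def
  by (clarify, rule partial_y_eqI, rule DERIV_add) (rule weight_span_DERIV_y; assumption)+

lemma weight_span_partial_x: "f \<in> weight_span \<Longrightarrow> partial_x f \<in> weight_span"
proof (induction rule: weight_span.induct)
  case (scaled_weight r a b c)
  show ?case
    by (rule weight_span.cong[OF _ agree_sym[OF partial_x_weight]])
       (intro weight_span.add weight_span.scaled_weight)
next
  case (add f g)
  then show ?case
    by (intro weight_span.cong[OF weight_span.add agree_sym[OF partial_x_add]])
next
  case (cong f g)
  then show ?case using partial_x_cong weight_span.cong by blast
qed

lemma weight_span_partial_y: "f \<in> weight_span \<Longrightarrow> partial_y f \<in> weight_span"
  by (simp add: partial_y_swap weight_span_partial_x weight_span_swap)

text \<open>No general theorem on mixed derivatives is involved: both sides are computed explicitly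
  for one weight and the result is extended by linearity.\<close>

lemma partial_x_partial_y_commute:
  "f \<in> weight_span \<Longrightarrow> partial_x (partial_y f) \<doteq> partial_y (partial_x f)"
proof (induction rule: weight_span.induct)
  case (scaled_weight r a b c)
  let ?W = weight
  \<comment> \<open>A first derivative of a weight has two terms, so the second derivative calls for
    a rule for sums of two scaled weights.\<close>
  have x: "partial_x (\<lambda>p. r1 * ?W a1 b1 c1 p + r2 * ?W a2 b2 c2 p) \<doteq>
      (\<lambda>p. (r1 * a1 * ?W (a1 - 1) b1 c1 p + - r1 * c1 * ?W a1 b1 (c1 - 1) p)
        + (r2 * a2 * ?W (a2 - 1) b2 c2 p + - r2 * c2 * ?W a2 b2 (c2 - 1) p))"
    for r1 r2 a1 a2 b1 b2 c1 c2
    by (rule agree_trans[OF partial_x_add agree_add])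
       (rule weight_span.scaled_weight partial_x_weight)+
  have y: "partial_y (\<lambda>p. r1 * ?W a1 b1 c1 p + r2 * ?W a2 b2 c2 p) \<doteq>
      (\<lambda>p. (r1 * b1 * ?W a1 (b1 - 1) c1 p + - r1 * c1 * ?W a1 b1 (c1 - 1) p)
        + (r2 * b2 * ?W a2 (b2 - 1) c2 p + - r2 * c2 * ?W a2 b2 (c2 - 1) p))"
    for r1 r2 a1 a2 b1 b2 c1 c2
    by (rule agree_trans[OF partial_y_add agree_add])
       (rule weight_span.scaled_weight partial_y_weight)+
  have "partial_x (partial_y (\<lambda>p. r * ?W a b c p))
      \<doteq> partial_x (\<lambda>p. r * b * ?W a (b - 1) c p + - r * c * ?W a b (c - 1) p)"
    by (rule partial_x_cong[OF partial_y_weight])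
  also have "\<dots> \<doteq> (\<lambda>p. (r * b * a * ?W (a - 1) (b - 1) c p + - (r * b) * c * ?W a (b - 1) (c - 1) p)
        + (- r * c * a * ?W (a - 1) b (c - 1) p + - (- r * c) * (c - 1) * ?W a b (c - 1 - 1) p))"
    by (rule x)
  \<comment> \<open>The two middle terms trade places; this is the whole symmetry between x and
    y.\<close>
  also have "\<dots> = (\<lambda>p. (r * a * b * ?W (a - 1) (b - 1) c p + - (r * a) * c * ?W (a - 1) b (c - 1) p)
        + (- r * c * b * ?W a (b - 1) (c - 1) p + - (- r * c) * (c - 1) * ?W a b (c - 1 - 1) p))"
    by (rule ext) (simp add: algebra_simps)
  also have "\<dots> \<doteq> partial_y (\<lambda>p. r * a * ?W (a - 1) b c p + - r * c * ?W a b (c - 1) p)"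
    by (rule agree_sym[OF y])
  also have "\<dots> \<doteq> partial_y (partial_x (\<lambda>p. r * ?W a b c p))"
    by (rule agree_sym[OF partial_y_cong[OF partial_x_weight]])
  finally show ?case .
next
  case (add f g)
  note xy = weight_span_partial_x weight_span_partial_y
  have "partial_x (partial_y (\<lambda>p. f p + g p)) \<doteq> partial_x (\<lambda>p. partial_y f p + partial_y g p)"
    by (intro partial_x_cong partial_y_add add)
  also have "\<dots> \<doteq> (\<lambda>p. partial_x (partial_y f) p + partial_x (partial_y g) p)"
    by (intro partial_x_add xy add)
  also have "\<dots> \<doteq> (\<lambda>p. partial_y (partial_x f) p + partial_y (partial_x g) p)"
    using add.IH by (simp add: agree_def)
  also have "\<dots> \<doteq> partial_y (\<lambda>p. partial_x f p + partial_x g p)"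
    by (intro agree_sym[OF partial_y_add] xy add)
  also have "\<dots> \<doteq> partial_y (partial_x (\<lambda>p. f p + g p))"
    by (intro agree_sym[OF partial_y_cong] partial_x_add add)
  finally show ?case .
next
  case (cong f g)
  have "partial_x (partial_y g) \<doteq> partial_x (partial_y f)"
    by (intro partial_x_cong partial_y_cong agree_sym[OF cong.hyps(2)])
  also note cong.IH
  also have "partial_y (partial_x f) \<doteq> partial_y (partial_x g)"
    by (intro partial_x_cong partial_y_cong cong.hyps(2))
  finally show ?case .
qed

section \<open>The conjugated Euler operators and their commutation\<close>

text \<open>The conjugates of \<open>x \<partial>\<^sub>x + c\<close> and \<open>y \<partial>\<^sub>y + c\<close> by \<open>(1 - x - y) powr g\<close>.\<close>

definition euler_x :: "real \<Rightarrow> real \<Rightarrow> (real \<times> real \<Rightarrow> real) \<Rightarrow> real \<times> real \<Rightarrow> real" where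
  "euler_x g c f = (\<lambda>(x, y). x * partial_x f (x, y) + (c - g * (x / (1 - x - y))) * f (x, y))"

definition euler_y :: "real \<Rightarrow> real \<Rightarrow> (real \<times> real \<Rightarrow> real) \<Rightarrow> real \<times> real \<Rightarrow> real" where
  "euler_y g c f = (\<lambda>(x, y). y * partial_y f (x, y) + (c - g * (y / (1 - x - y))) * f (x, y))"

lemma euler_x_apply:
  "euler_x g c f (x, y) = x * partial_x f (x, y) + (c - g * (x / (1 - x - y))) * f (x, y)"
  by (simp add: euler_x_def)

lemma euler_y_apply:
  "euler_y g c f (x, y) = y * partial_y f (x, y) + (c - g * (y / (1 - x - y))) * f (x, y)"
  by (simp add: euler_y_def)

lemma euler_y_swap: "euler_y g c f = euler_x g c (f \<circ> prod.swap) \<circ> prod.swap"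
  by (simp add: euler_x_def euler_y_def partial_y_swap fun_eq_iff diff_right_commute)

lemma euler_x_cong: "f \<doteq> g \<Longrightarrow> euler_x c d f \<doteq> euler_x c d g"
  using partial_x_cong[of f g] by (auto simp: agree_def euler_x_def)

lemma euler_y_cong: "f \<doteq> g \<Longrightarrow> euler_y c d f \<doteq> euler_y c d g"
  unfolding euler_y_swap agree_swap by (intro euler_x_cong) (simp add: agree_swap)

lemma weight_span_euler_x:
  assumes "f \<in> weight_span"
  shows "euler_x g c f \<in> weight_span"
proof -
  \<comment> \<open>In the interior the function x is \<open>weight 1 0 0\<close>, the constant 1 is
    \<open>weight 0 0 0\<close>, and x / (1 - x - y) is \<open>weight 1 0 (-1)\<close>.\<close>
  let ?h = "\<lambda>p. 1 * weight 1 0 0 p * partial_x f p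
      + (c * weight 0 0 0 p + - g * weight 1 0 (-1) p) * f p"
  have "?h \<in> weight_span"
    using assms by (intro weight_span.add weight_span_mult weight_span_partial_x
      weight_span.scaled_weight)
  moreover have "?h \<doteq> euler_x g c f"
    unfolding agree_def
  proof clarify
    fix x y :: real assume "(x, y) \<in> interior std_triangle"
    then show "?h (x, y) = euler_x g c f (x, y)"
      using interior_std_triangleD[of x y]
      by (simp add: weight_def euler_x_def powr_minus divide_inverse)
  qed
  ultimately show ?thesis by (rule weight_span.cong)
qed

lemma weight_span_euler_y: "f \<in> weight_span \<Longrightarrow> euler_y g c f \<in> weight_span"
  unfolding euler_y_swap by (intro weight_span_swap weight_span_euler_x)

lemma DERIV_ratio:
  assumes "(x, y) \<in> interior std_triangle"
  shows "((\<lambda>s. s / (1 - s - y)) has_real_derivative (1 - y) / (1 - x - y)\<^sup>2) (at x)"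
    and "((\<lambda>s. y / (1 - s - y)) has_real_derivative y / (1 - x - y)\<^sup>2) (at x)"
    and "((\<lambda>t. x / (1 - x - t)) has_real_derivative x / (1 - x - y)\<^sup>2) (at y)"
  using interior_std_triangleD[OF assms]
  by (auto intro!: derivative_eq_intros simp: power2_eq_square field_simps)

text \<open>The two operators differ by the multiple \<open>d - c\<close> of the identity, so the
  expanded composition is symmetric in \<open>c\<close> and \<open>d\<close>.\<close>

lemma euler_x_euler_x_commute:
  assumes "f \<in> weight_span"
  shows "euler_x g c (euler_x g d f) \<doteq> euler_x g d (euler_x g c f)"
proof -
  have deriv: "partial_x (euler_x g e f) (x, y)
      = partial_x f (x, y) + x * partial_x (partial_x f) (x, y)
        + (e - g * (x / (1 - x - y))) * partial_x f (x, y)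
        - g * ((1 - y) / (1 - x - y)\<^sup>2) * f (x, y)"
    if "(x, y) \<in> interior std_triangle" for x y e
    unfolding euler_x_def prod.case
    by (rule partial_x_eqI, unfold prod.case)
       (rule derivative_eq_intros weight_span_DERIV_x weight_span_partial_x DERIV_ratio(1)
          that assms refl | simp)+
  show ?thesis
    unfolding agree_def
  proof clarify
    fix x y :: real assume p: "(x, y) \<in> interior std_triangle"
    show "euler_x g c (euler_x g d f) (x, y) = euler_x g d (euler_x g c f) (x, y)"
      unfolding euler_x_apply deriv[OF p] by algebra
  qed
qed

lemma euler_y_euler_y_commute:
  assumes "f \<in> weight_span"
  shows "euler_y g c (euler_y g d f) \<doteq> euler_y g d (euler_y g c f)"
  using euler_x_euler_x_commute[OF weight_span_swap[OF assms]]
  by (simp only: euler_y_swap agree_swap comp_swap_swap)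

text \<open>Besides the mixed derivatives, the terms to compare come from differentiating the
  coefficients. Both orders give - g x y / (1 - x - y)^2 times \<open>f\<close>, since x times the
  x-derivative of y / (1 - x - y) equals y times the y-derivative of x / (1 - x - y).\<close>

lemma euler_x_euler_y_commute:
  assumes "f \<in> weight_span"
  shows "euler_x g c (euler_y g d f) \<doteq> euler_y g d (euler_x g c f)"
proof -
  have x: "partial_x (euler_y g d f) (x, y)
      = y * partial_x (partial_y f) (x, y)
        + (d - g * (y / (1 - x - y))) * partial_x f (x, y) - g * (y / (1 - x - y)\<^sup>2) * f (x, y)"
    if "(x, y) \<in> interior std_triangle" for x y
    unfolding euler_y_def prod.case
    by (rule partial_x_eqI, unfold prod.case)
       (rule derivative_eq_intros weight_span_DERIV_x weight_span_partial_y DERIV_ratio(2)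
          that assms refl | simp)+
  have y: "partial_y (euler_x g c f) (x, y)
      = x * partial_y (partial_x f) (x, y)
        + (c - g * (x / (1 - x - y))) * partial_y f (x, y) - g * (x / (1 - x - y)\<^sup>2) * f (x, y)"
    if "(x, y) \<in> interior std_triangle" for x y
    unfolding euler_x_def prod.case
    by (rule partial_y_eqI, unfold prod.case)
       (rule derivative_eq_intros weight_span_DERIV_y weight_span_partial_x DERIV_ratio(3)
          that assms refl | simp)+
  show ?thesis
    unfolding agree_def
  proof clarify
    fix x y :: real assume p: "(x, y) \<in> interior std_triangle"
    have xy: "partial_x (partial_y f) (x, y) = partial_y (partial_x f) (x, y)"
      using partial_x_partial_y_commute[OF assms] p by (simp add: agree_def)
    show "euler_x g c (euler_y g d f) (x, y) = euler_y g d (euler_x g c f) (x, y)"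
      unfolding euler_x_apply euler_y_apply x[OF p] y[OF p] xy by algebra
  qed
qed

section \<open>Compositions of commuting operators\<close>

lemma compose_list_simps [simp]:
  "compose_list [] f = f"
  "compose_list (F # Fs) f = F (compose_list Fs f)"
  "compose_list (Fs @ Gs) f = compose_list Fs (compose_list Gs f)"
  by (simp_all add: compose_list_def) (induction Fs, simp_all)

text \<open>The additive constants vary freely but the exponent \<open>g\<close> is shared: an
  \<open>euler_x\<close> and an \<open>euler_y\<close> with different exponents do not commute in
  general. This is where a common \<gamma> matters.\<close>

definition euler_ops :: "real \<Rightarrow> ((real \<times> real \<Rightarrow> real) \<Rightarrow> real \<times> real \<Rightarrow> real) set" where
  "euler_ops g = range (euler_x g) \<union> range (euler_y g)"

lemma euler_ops_cong: "F \<in> euler_ops g \<Longrightarrow> f \<doteq> h \<Longrightarrow> F f \<doteq> F h"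
  by (auto simp: euler_ops_def intro: euler_x_cong euler_y_cong)

lemma euler_ops_weight_span: "F \<in> euler_ops g \<Longrightarrow> f \<in> weight_span \<Longrightarrow> F f \<in> weight_span"
  by (auto simp: euler_ops_def intro: weight_span_euler_x weight_span_euler_y)

lemma euler_ops_commute:
  "F \<in> euler_ops g \<Longrightarrow> G \<in> euler_ops g \<Longrightarrow> f \<in> weight_span \<Longrightarrow> F (G f) \<doteq> G (F f)"
  by (auto simp: euler_ops_def intro: euler_x_euler_x_commute euler_y_euler_y_commute
      euler_x_euler_y_commute agree_sym[OF euler_x_euler_y_commute])

lemma compose_euler_weight_span:
  "set Fs \<subseteq> euler_ops g \<Longrightarrow> f \<in> weight_span \<Longrightarrow> compose_list Fs f \<in> weight_span"
proof (induction Fs)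
  case (Cons F Fs)
  then show ?case using euler_ops_weight_span[of F g] by simp
qed simp

text \<open>Each exchange of neighbours takes place on a function of the form
  \<open>compose_list Fs f\<close>, which is why membership in the span has to be carried
  along.\<close>

lemma compose_euler_move:
  assumes "set Fs \<subseteq> euler_ops g" "F \<in> euler_ops g" "f \<in> weight_span"
  shows "compose_list Fs (F f) \<doteq> F (compose_list Fs f)"
  using assms(1)
proof (induction Fs)
  case (Cons G Fs)
  then have "G (compose_list Fs (F f)) \<doteq> G (F (compose_list Fs f))"
    by (intro euler_ops_cong[of G g]) auto
  also have "\<dots> \<doteq> F (G (compose_list Fs f))"
    using Cons.prems assms
    by (intro euler_ops_commute[of G g F] compose_euler_weight_span[of Fs g]) auto
  finally show ?case by simp
qed simp

text \<open>The head of \<open>Fs\<close> is located in \<open>Gs\<close>, the induction hypothesis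
  handles both lists without it, and \<open>compose_euler_move\<close> carries it back to its place
  in \<open>Gs\<close>.\<close>

lemma compose_euler_mset:
  assumes "mset Fs = mset Gs" "set Fs \<subseteq> euler_ops g" "f \<in> weight_span"
  shows "compose_list Fs f \<doteq> compose_list Gs f"
  using assms(1,2)
proof (induction Fs arbitrary: Gs)
  case (Cons F Fs)
  then obtain G1 G2 where Gs: "Gs = G1 @ F # G2"
    by (metis list.set_intros(1) mset_eq_setD split_list)
  have subset: "set (G1 @ F # G2) \<subseteq> euler_ops g"
    using Cons.prems Gs mset_eq_setD by blast
  have "compose_list Fs f \<doteq> compose_list (G1 @ G2) f"
    using Cons.prems Gs by (intro Cons.IH) auto
  then have "F (compose_list Fs f) \<doteq> F (compose_list G1 (compose_list G2 f))"
    using Cons.prems(2) by (intro euler_ops_cong[of F g]) auto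
  also have "\<dots> \<doteq> compose_list G1 (F (compose_list G2 f))"
    using subset assms(3)
    by (intro agree_sym[OF compose_euler_move[of G1 g F]] compose_euler_weight_span[of G2 g]) auto
  finally show ?case by (simp add: Gs)
qed simp

section \<open>Rodrigues operators as products of Euler operators\<close>

text \<open>By the product rule one derivative consumes one power of x; that power becomes the
  factor x of the Euler operator, and the exponent of x supplies its constant.\<close>

lemma partial_x_weight_mult:
  assumes "f \<in> weight_span"
  shows "partial_x (\<lambda>p. weight (a + 1) b g p * f p) \<doteq> (\<lambda>p. weight a b g p * euler_x g (a + 1) f p)"
  unfolding agree_def
proof clarify
  fix x y :: real assume p: "(x, y) \<in> interior std_triangle"
  have "partial_x (\<lambda>p. weight (a + 1) b g p * f p) (x, y)
      = ((a + 1) * weight a b g (x, y) - g * weight (a + 1) b (g - 1) (x, y)) * f (x, y)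
        + weight (a + 1) b g (x, y) * partial_x f (x, y)"
    using DERIV_mult[OF DERIV_weight_x[OF p, of "a + 1" b g] weight_span_DERIV_x[OF assms p]]
    by (intro partial_x_eqI) (simp add: algebra_simps)
  \<comment> \<open>Here \<open>weight (a + 1) b (g - 1)\<close> is \<open>weight a b g\<close>
    times x / (1 - x - y), which is the correction term in \<open>euler_x\<close>.\<close>
  also have "\<dots> = weight a b g (x, y) * euler_x g (a + 1) f (x, y)"
    using interior_std_triangleD[OF p]
    by (simp add: weight_def euler_x_def powr_add powr_diff) (simp add: field_simps)
  finally show "partial_x (\<lambda>p. weight (a + 1) b g p * f p) (x, y)
      = weight a b g (x, y) * euler_x g (a + 1) f (x, y)" .
qed

definition euler_x_list :: "real \<Rightarrow> real \<Rightarrow> nat \<Rightarrow> ((real \<times> real \<Rightarrow> real) \<Rightarrow> real \<times> real \<Rightarrow> real) list"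
  where "euler_x_list g a m = map (\<lambda>i. euler_x g (a + real i)) [1..<Suc m]"

definition euler_y_list :: "real \<Rightarrow> real \<Rightarrow> nat \<Rightarrow> ((real \<times> real \<Rightarrow> real) \<Rightarrow> real \<times> real \<Rightarrow> real) list"
  where "euler_y_list g b m = map (\<lambda>i. euler_y g (b + real i)) [1..<Suc m]"

lemma set_euler_lists:
  "F \<in> set (euler_x_list g a m) \<Longrightarrow> F \<in> euler_ops g"
  "F \<in> set (euler_y_list g b m) \<Longrightarrow> F \<in> euler_ops g"
  by (auto simp: euler_x_list_def euler_y_list_def euler_ops_def)

lemma funpow_partial_x_cong: "f \<doteq> g \<Longrightarrow> (partial_x ^^ m) f \<doteq> (partial_x ^^ m) g"
  by (induction m) (auto intro: partial_x_cong)

lemma funpow_partial_x_weight_mult: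
  "f \<in> weight_span \<Longrightarrow> (partial_x ^^ m) (\<lambda>p. weight (a + real m) b g p * f p)
    \<doteq> (\<lambda>p. weight a b g p * compose_list (euler_x_list g a m) f p)"
proof (induction m arbitrary: f)
  case 0
  show ?case by (simp add: euler_x_list_def)
next
  case (Suc m)
  \<comment> \<open>The innermost derivative is split off. It meets the highest exponent and so
    yields the factor with the largest shift, which acts first and hence stands last in the list;
    the hypothesis is then used for the image of \<open>f\<close> under that factor.\<close>
  have unfold: "(partial_x ^^ Suc m) (\<lambda>p. weight (a + real (Suc m)) b g p * f p)
      = (partial_x ^^ m) (partial_x (\<lambda>p. weight ((a + real m) + 1) b g p * f p))"
    by (simp add: funpow_Suc_right add_ac del: funpow.simps)
  have "(partial_x ^^ m) (partial_x (\<lambda>p. weight ((a + real m) + 1) b g p * f p))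
      \<doteq> (partial_x ^^ m) (\<lambda>p. weight (a + real m) b g p * euler_x g (a + real m + 1) f p)"
    by (intro funpow_partial_x_cong partial_x_weight_mult Suc.prems)
  also have "\<dots> \<doteq> (\<lambda>p. weight a b g p
      * compose_list (euler_x_list g a m) (euler_x g (a + real m + 1) f) p)"
    by (intro Suc.IH weight_span_euler_x Suc.prems)
  also have "compose_list (euler_x_list g a m) (euler_x g (a + real m + 1) f)
      = compose_list (euler_x_list g a (Suc m)) f"
    by (simp add: euler_x_list_def add_ac)
  finally show ?case unfolding unfold .
qed

lemma funpow_partial_y_swap:
  "(partial_y ^^ m) f = (partial_x ^^ m) (f \<circ> prod.swap) \<circ> prod.swap"
proof (induction m)
  case (Suc m)
  have "(partial_y ^^ Suc m) f = partial_y ((partial_y ^^ m) f)"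
    by simp
  also have "\<dots> = partial_x ((partial_x ^^ m) (f \<circ> prod.swap)) \<circ> prod.swap"
    by (simp only: Suc.IH partial_y_swap comp_swap_swap)
  finally show ?case by (simp only: funpow.simps o_apply[of partial_x])
qed (simp add: comp_swap_swap)

lemma compose_euler_y_swap:
  "compose_list (euler_y_list g b m) f
    = compose_list (euler_x_list g b m) (f \<circ> prod.swap) \<circ> prod.swap"
proof -
  have "compose_list (map (\<lambda>i. euler_y g (b + real i)) is) f
      = compose_list (map (\<lambda>i. euler_x g (b + real i)) is) (f \<circ> prod.swap) \<circ> prod.swap" for "is"
    by (induction "is") (simp_all only: list.map compose_list_simps euler_y_swap comp_swap_swap)
  then show ?thesis by (simp add: euler_x_list_def euler_y_list_def)
qed

lemma funpow_partial_y_weight_mult: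
  assumes "f \<in> weight_span"
  shows "(partial_y ^^ m) (\<lambda>p. weight a (b + real m) g p * f p)
    \<doteq> (\<lambda>p. weight a b g p * compose_list (euler_y_list g b m) f p)"
proof -
  have "(\<lambda>p. weight a (b + real m) g p * f p) \<circ> prod.swap
      = (\<lambda>p. weight (b + real m) a g p * (f \<circ> prod.swap) p)"
    by (auto simp: weight_swap)
  moreover have "(\<lambda>p. weight a b g p * compose_list (euler_y_list g b m) f p)
      = (\<lambda>p. weight b a g p * compose_list (euler_x_list g b m) (f \<circ> prod.swap) p) \<circ> prod.swap"
    by (auto simp: weight_swap compose_euler_y_swap)
  ultimately show ?thesis
    using funpow_partial_x_weight_mult[OF weight_span_swap[OF assms], of m b a g]
    by (simp add: funpow_partial_y_swap agree_swap)
qed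

lemma funpow_partial_y_cong: "f \<doteq> g \<Longrightarrow> (partial_y ^^ m) f \<doteq> (partial_y ^^ m) g"
  by (induction m) (auto intro: partial_y_cong)

lemma rodrigues_op_cong:
  assumes "f \<doteq> h"
  shows "rodrigues_op a b g n k f \<doteq> rodrigues_op a b g n k h"
proof -
  have "(partial_x ^^ (n - k)) ((partial_y ^^ k)
        (\<lambda>(x, y). weight a b g (x, y) * x ^ (n - k) * y ^ k * f (x, y)))
      \<doteq> (partial_x ^^ (n - k)) ((partial_y ^^ k)
        (\<lambda>(x, y). weight a b g (x, y) * x ^ (n - k) * y ^ k * h (x, y)))"
    using assms by (intro funpow_partial_x_cong funpow_partial_y_cong) (auto simp: agree_def)
  then show ?thesis by (auto simp: agree_def rodrigues_op_def)
qed

text \<open>The monomial merges into the weight. The y-derivatives then lower its second exponent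
  back to \<open>b\<close> and the x-derivatives its first back to \<open>a\<close>, each leaving an
  Euler factor, until the original weight remains and cancels.\<close>

lemma rodrigues_op_euler:
  assumes "f \<in> weight_span"
  shows "rodrigues_op a b g n k f
    \<doteq> compose_list (euler_x_list g a (n - k) @ euler_y_list g b k) f"
proof -
  let ?m = "n - k"
  let ?Yf = "compose_list (euler_y_list g b k) f"
  have "(\<lambda>(x, y). weight a b g (x, y) * x ^ ?m * y ^ k * f (x, y))
      \<doteq> (\<lambda>p. weight (a + real ?m) (b + real k) g p * f p)"
    unfolding agree_def
  proof clarify
    fix x y :: real assume "(x, y) \<in> interior std_triangle"
    then show "weight a b g (x, y) * x ^ ?m * y ^ k * f (x, y)
        = weight (a + real ?m) (b + real k) g (x, y) * f (x, y)"
      using interior_std_triangleD[of x y]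
      by (simp add: weight_def powr_add powr_realpow del: of_nat_diff)
  qed
  then have "(partial_x ^^ ?m) ((partial_y ^^ k)
        (\<lambda>(x, y). weight a b g (x, y) * x ^ ?m * y ^ k * f (x, y)))
      \<doteq> (partial_x ^^ ?m) ((partial_y ^^ k) (\<lambda>p. weight (a + real ?m) (b + real k) g p * f p))"
    by (intro funpow_partial_x_cong funpow_partial_y_cong)
  also have "\<dots> \<doteq> (partial_x ^^ ?m) (\<lambda>p. weight (a + real ?m) b g p * ?Yf p)"
    by (intro funpow_partial_x_cong funpow_partial_y_weight_mult assms)
  also have "\<dots> \<doteq> (\<lambda>p. weight a b g p * compose_list (euler_x_list g a ?m) ?Yf p)"
    by (intro funpow_partial_x_weight_mult compose_euler_weight_span[of _ g] subsetI assms)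
       (rule set_euler_lists)
  finally have *: "\<forall>p\<in>interior std_triangle. (partial_x ^^ ?m) ((partial_y ^^ k)
        (\<lambda>(x, y). weight a b g (x, y) * x ^ ?m * y ^ k * f (x, y))) p
      = weight a b g p * compose_list (euler_x_list g a ?m) ?Yf p"
    by (simp add: agree_def)
  \<comment> \<open>This permits cancelling the weight against the prefactor
    \<open>1 / weight a b g p\<close>.\<close>
  have "weight a b g p \<noteq> 0" if "p \<in> interior std_triangle" for p
    using that interior_std_triangleD[of "fst p" "snd p"] by (cases p) (simp add: weight_def)
  with * show ?thesis by (simp add: agree_def rodrigues_op_def)
qed

section \<open>Reordering the Rodrigues operators\<close>

text \<open>Flattening all operators into one list of Euler factors makes
  \<open>compose_euler_mset\<close> applicable. \<open>rodrigues_op_cong\<close> allows the inner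
  composition to be replaced first, and the replacement lies in the span.\<close>

lemma compose_rodrigues_op:
  assumes "f \<in> weight_span"
  shows "compose_list (map (\<lambda>j. rodrigues_op (\<alpha> j) (\<beta> j) g (n j) (k j)) js) f
    \<doteq> compose_list (concat (map (\<lambda>j. euler_x_list g (\<alpha> j) (n j - k j) @ euler_y_list g (\<beta> j) (k j)) js)) f"
    (is "_ \<doteq> compose_list (concat (map ?E js)) f")
proof (induction js)
  case (Cons j js)
  let ?D = "\<lambda>j. rodrigues_op (\<alpha> j) (\<beta> j) g (n j) (k j)"
  have "?D j (compose_list (map ?D js) f) \<doteq> ?D j (compose_list (concat (map ?E js)) f)"
    by (intro rodrigues_op_cong Cons.IH)
  also have "\<dots> \<doteq> compose_list (?E j) (compose_list (concat (map ?E js)) f)"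
    by (intro rodrigues_op_euler compose_euler_weight_span[of _ g] assms)
       (auto intro: set_euler_lists)
  finally show ?case by simp
qed simp

lemma compose_rodrigues_op_mset:
  assumes "f \<in> weight_span" "mset is = mset js"
  shows "compose_list (map (\<lambda>j. rodrigues_op (\<alpha> j) (\<beta> j) g (n j) (k j)) is) f
    \<doteq> compose_list (map (\<lambda>j. rodrigues_op (\<alpha> j) (\<beta> j) g (n j) (k j)) js) f"
proof -
  let ?E = "\<lambda>j. euler_x_list g (\<alpha> j) (n j - k j) @ euler_y_list g (\<beta> j) (k j)"
  \<comment> \<open>The multiset of a concatenation is the sum of the multisets of its blocks, so it
    depends only on the multiset of indices.\<close>
  have "mset (concat (map ?E is)) = mset (concat (map ?E js))"
    by (simp only: mset_concat sum_mset_sum_list[symmetric] mset_map assms(2))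
  moreover have "set (concat (map ?E is)) \<subseteq> euler_ops g"
    by (auto intro: set_euler_lists)
  ultimately have "compose_list (concat (map ?E is)) f \<doteq> compose_list (concat (map ?E js)) f"
    using assms(1) by (rule compose_euler_mset)
  from agree_trans[OF agree_trans[OF compose_rodrigues_op[OF assms(1)] this]
      agree_sym[OF compose_rodrigues_op[OF assms(1)]]]
  show ?thesis .
qed

theorem corollary3p6:
  fixes r :: nat and \<alpha> \<beta> :: "nat \<Rightarrow> real" and \<gamma> :: real
    and n k :: "nat \<Rightarrow> nat" and \<pi> :: "nat \<Rightarrow> nat"
    and D :: "nat \<Rightarrow> (real \<times> real \<Rightarrow> real) \<Rightarrow> real \<times> real \<Rightarrow> real"
  assumes "r \<ge> 2"
    and "\<And>j. j \<in> {1..r} \<Longrightarrow> \<alpha> j > -1"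
    and "\<And>j. j \<in> {1..r} \<Longrightarrow> \<beta> j > -1"
    and "\<gamma> > -1"
    and "\<And>i j. i \<in> {1..r} \<Longrightarrow> j \<in> {1..r} \<Longrightarrow> i \<noteq> j \<Longrightarrow> (\<alpha> i, \<beta> i) \<noteq> (\<alpha> j, \<beta> j)"
    and "\<And>j. j \<in> {1..r} \<Longrightarrow> k j \<le> n j"
    and "\<pi> permutes {1..r}"
  defines "D \<equiv> (\<lambda>j. rodrigues_op (\<alpha> j) (\<beta> j) \<gamma> (n j) (k j))"
  shows "\<forall>p \<in> interior std_triangle.
      U_fun r \<alpha> \<beta> \<gamma> n k p
        = compose_list (map D (rev [1..<Suc r]))
            (\<lambda>(x, y). (1 - x - y) ^ (\<Sum>j=1..r. n j)) p
    \<and> compose_list (map D (rev [1..<Suc r]))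
            (\<lambda>(x, y). (1 - x - y) ^ (\<Sum>j=1..r. n j)) p
        = compose_list (map (\<lambda>j. D (\<pi> j)) [1..<Suc r])
            (\<lambda>(x, y). (1 - x - y) ^ (\<Sum>j=1..r. n j)) p"
proof -
  let ?f = "\<lambda>(x, y). (1 - x - y) ^ (\<Sum>j=1..r. n j) :: real"
  \<comment> \<open>The starting function is a weight with exponents 0 in x and y; for positive 1 -
    x - y the natural power is a \<open>powr\<close>.\<close>
  have "(\<lambda>p. 1 * weight 0 0 (real (\<Sum>j=1..r. n j)) p) \<doteq> ?f"
    unfolding agree_def
  proof clarify
    fix x y :: real assume "(x, y) \<in> interior std_triangle"
    then show "1 * weight 0 0 (real (\<Sum>j=1..r. n j)) (x, y) = (1 - x - y) ^ (\<Sum>j=1..r. n j)"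
      using interior_std_triangleD[of x y] by (simp add: weight_def powr_realpow del: of_nat_sum)
  qed
  then have f: "?f \<in> weight_span"
    by (rule weight_span.cong[OF weight_span.scaled_weight])
  \<comment> \<open>A permutation preserves the multiset of indices, as does reversal, so both index
    lists have the same multiset.\<close>
  have "image_mset \<pi> (mset_set {1..r}) = mset_set {1..r}"
    using \<open>\<pi> permutes {1..r}\<close>
    by (simp add: image_mset_mset_set permutes_image permutes_inj_on)
  moreover have "mset [1..<Suc r] = mset_set {1..r}"
    by (simp only: mset_upt atLeastLessThanSuc_atLeastAtMost)
  ultimately have "mset (rev [1..<Suc r]) = mset (map \<pi> [1..<Suc r])"
    by (simp only: mset_rev mset_map)
  \<comment> \<open>The first equation is the definition of \<open>U_fun\<close>; the second is the
    reordering just obtained.\<close>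
  from compose_rodrigues_op_mset[OF f this, of \<alpha> \<beta> \<gamma> n k] show ?thesis
    unfolding agree_def D_def U_fun_def map_map o_def by blast
qed

end
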